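(* Let $f=f^++f^-$ with $(f^+)'\ge0$, $(f^-)'\le0$, let $\delta,\Delta x,\Delta t>0$, let the integer states $q_i^n\in\mathbb Z$ evolve by $$q_i^{n+1}=q_i^n-\bigl(\phi^+(q_i^n)+\phi^-(q_{i+1}^n)-\phi^+(q_{i-1}^n)-\phi^-(q_i^n)\bigr),\qquad \phi^\pm(q)=\mathrm{round}\!\left(f^\pm(\delta q)\frac{\Delta t}{\Delta x}\delta^{-1}\right),$$ and let $u_i^n=\delta q_i^n$. Then the reconstructed one-step increment differs from the classical split finite-volume increment by $\mathcal O(\delta)$: $$u_i^{n+1}-u_i^n=-\frac{\Delta t}{\Delta x}\bigl(\mathcal F(u_i^n,u_{i+1}^n)-\mathcal F(u_{i-1}^n,u_i^n)\bigr)+\mathcal O(\delta).$$ Equivalently, after division by $\Delta t$, $$\frac{u_i^{n+1}-u_i^n}{\Delta t}=\mathcal O_h[u^n]_i+\mathcal O\!\left(\frac{\delta}{\Delta t}\right).$$ Under fixed CFL scaling ($\Delta t/\Delta x$ equal to a fixed positive constant), the operator-level residual is therefore $\mathcal O(\delta/\Delta x)$.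
   Context: $\mathrm{round}:\mathbb R\to\mathbb Z$ is rounding to the nearest integer, so $|\mathrm{round}(x)-x|\le\tfrac12$. The classical split numerical flux is $\mathcal F(u_L,u_R):=f^+(u_L)+f^-(u_R)$, and the classical split finite-volume operator is $\mathcal O_h[u]_i:=-\frac{\mathcal F(u_i,u_{i+1})-\mathcal F(u_{i-1},u_i)}{\Delta x}$ (not to be confused with the Landau symbol $\mathcal O(\cdot)$). The Landau symbols mean bounds with a constant independent of $i,n$ and of $\delta,\Delta x,\Delta t$ (in the last assertion the constant may depend on the fixed ratio $\Delta t/\Delta x$). *)

theory Defs
  imports "HOL-Analysis.Derivative"
begin

text \<open>Rounding to a nearest integer, with the choice at half-integers left open;
  the library function \<open>round\<close> (half-integers rounded up) is one instance.\<close>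

definition nearest_rounding :: "(real \<Rightarrow> int) \<Rightarrow> bool" where
  "nearest_rounding rnd \<longleftrightarrow>
     (\<forall>x k. \<bar>real_of_int (rnd x) - x\<bar> \<le> \<bar>real_of_int k - x\<bar>)"

lemma nearest_rounding_round: "nearest_rounding round"
  unfolding nearest_rounding_def
  by (metis round_diff_minimal abs_minus_commute)

lemma nearest_rounding_half:
  assumes "nearest_rounding rnd"
  shows "\<bar>real_of_int (rnd x) - x\<bar> \<le> 1 / 2"
  using assms of_int_round_abs_le[of x] unfolding nearest_rounding_def
  by (meson order_trans)

definition split_flux :: "(real \<Rightarrow> real) \<Rightarrow> (real \<Rightarrow> real) \<Rightarrow> real \<Rightarrow> real \<Rightarrow> real" where
  "split_flux fp fm uL uR = fp uL + fm uR"

definition fv_operator ::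
    "(real \<Rightarrow> real) \<Rightarrow> (real \<Rightarrow> real) \<Rightarrow> real \<Rightarrow> (int \<Rightarrow> real) \<Rightarrow> int \<Rightarrow> real" where
  "fv_operator fp fm dx u i =
     - ((split_flux fp fm (u i) (u (i + 1)) - split_flux fp fm (u (i - 1)) (u i)) / dx)"

text \<open>The integer flux \<open>\<phi>\<^sup>\<plusminus>\<close> is obtained by taking \<open>g\<close> to be \<open>f\<^sup>\<plusminus>\<close>.\<close>

definition int_flux ::
    "(real \<Rightarrow> int) \<Rightarrow> (real \<Rightarrow> real) \<Rightarrow> real \<Rightarrow> real \<Rightarrow> real \<Rightarrow> int \<Rightarrow> int" where
  "int_flux rnd g \<delta> dx dt k = rnd (g (\<delta> * real_of_int k) * (dt / dx) * inverse \<delta>)"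

text \<open>States are written \<open>q n i\<close>, with time level \<open>n\<close> and cell index \<open>i\<close>.\<close>

definition int_evolution ::
    "(real \<Rightarrow> int) \<Rightarrow> (real \<Rightarrow> real) \<Rightarrow> (real \<Rightarrow> real) \<Rightarrow> real \<Rightarrow> real \<Rightarrow> real
      \<Rightarrow> (nat \<Rightarrow> int \<Rightarrow> int) \<Rightarrow> bool" where
  "int_evolution rnd fp fm \<delta> dx dt q \<longleftrightarrow>
     (\<forall>n i. q (n + 1) i = q n i -
        (int_flux rnd fp \<delta> dx dt (q n i) + int_flux rnd fm \<delta> dx dt (q n (i + 1))
         - int_flux rnd fp \<delta> dx dt (q n (i - 1)) - int_flux rnd fm \<delta> dx dt (q n i)))"

definition reconstruct :: "real \<Rightarrow> (nat \<Rightarrow> int \<Rightarrow> int) \<Rightarrow> nat \<Rightarrow> int \<Rightarrow> real" where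
  "reconstruct \<delta> q n i = \<delta> * real_of_int (q n i)"

definition increment_residual ::
    "(real \<Rightarrow> real) \<Rightarrow> (real \<Rightarrow> real) \<Rightarrow> real \<Rightarrow> real \<Rightarrow> (nat \<Rightarrow> int \<Rightarrow> real)
      \<Rightarrow> nat \<Rightarrow> int \<Rightarrow> real" where
  "increment_residual fp fm dx dt u n i =
     (u (n + 1) i - u n i) -
     (- (dt / dx) * (split_flux fp fm (u n i) (u n (i + 1))
                     - split_flux fp fm (u n (i - 1)) (u n i)))"

definition operator_residual ::
    "(real \<Rightarrow> real) \<Rightarrow> (real \<Rightarrow> real) \<Rightarrow> real \<Rightarrow> real \<Rightarrow> (nat \<Rightarrow> int \<Rightarrow> real)
      \<Rightarrow> nat \<Rightarrow> int \<Rightarrow> real" where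
  "operator_residual fp fm dx dt u n i =
     (u (n + 1) i - u n i) / dt - fv_operator fp fm dx (u n) i"

end

(* Each of the four rounded fluxes differs from its exact scaled value by at most 1/2, so
   after multiplication by \<delta> they perturb the increment by at most 4 * \<delta> / 2 = 2 * \<delta>. *)

theory Submission
  imports Defs
begin

text \<open>The scheme replaces each scaled flux
  \<open>dt / dx * g (\<delta> * k) / \<delta>\<close> by a nearest integer. The error is at most
  1/2 whatever the size of the argument, and reconstruction multiplies it by
  \<open>\<delta>\<close>. This cancels the \<open>inverse \<delta>\<close> under the rounding, so
  every flux is reproduced up to \<open>\<delta> / 2\<close> (\<open>int_flux_error\<close>),
  uniformly in the fluxes, the mesh and the states. The update is linear in its four fluxes, so the
  exact parts form the classical increment and only four rounding errors remain
  (\<open>increment_residual_bound\<close>). Dividing by \<open>dt\<close> gives the operator form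
  with the same constant (\<open>residual_bound_iff\<close>); at fixed \<open>dt / dx\<close>,
  \<open>\<delta> / dt\<close> is a constant multiple of \<open>\<delta> / dx\<close>.\<close>

lemma int_flux_error:
  assumes "nearest_rounding rnd" and "\<delta> > 0"
  shows "\<bar>\<delta> * real_of_int (int_flux rnd g \<delta> dx dt k) - dt / dx * g (\<delta> * real_of_int k)\<bar> \<le> \<delta> / 2"
proof -
  define x where "x = g (\<delta> * real_of_int k) * (dt / dx) * inverse \<delta>"
  \<comment> \<open>The argument of the rounding, once rescaled, is the exact flux contribution, so
    the error is \<open>\<delta>\<close> times a pure rounding error.\<close>
  have "\<delta> * x = dt / dx * g (\<delta> * real_of_int k)"
    using assms(2) by (simp add: x_def)
  then have "\<delta> * real_of_int (int_flux rnd g \<delta> dx dt k) - dt / dx * g (\<delta> * real_of_int k)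
      = \<delta> * (real_of_int (rnd x) - x)"
    unfolding int_flux_def x_def[symmetric] by (simp only: right_diff_distrib)
  moreover have "\<delta> * \<bar>real_of_int (rnd x) - x\<bar> \<le> \<delta> * (1 / 2)"
    using nearest_rounding_half[OF assms(1)] assms(2) by (intro mult_left_mono) auto
  ultimately show ?thesis
    using assms(2) by (simp add: abs_mult)
qed

lemma increment_residual_bound:
  assumes rnd: "nearest_rounding rnd" and "\<delta> > 0"
    and evol: "int_evolution rnd fp fm \<delta> dx dt q"
  shows "\<bar>increment_residual fp fm dx dt (reconstruct \<delta> q) n i\<bar> \<le> 2 * \<delta>"
proof -
  \<comment> \<open>\<open>e g j\<close> is the rescaled rounding error of the flux \<open>g\<close>
    in cell \<open>j\<close>.\<close>
  define e where "e g j = \<delta> * real_of_int (int_flux rnd g \<delta> dx dt (q n j))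
      - dt / dx * g (\<delta> * real_of_int (q n j))" for g j
  have e: "\<bar>e g j\<bar> \<le> \<delta> / 2" for g j
    unfolding e_def by (rule int_flux_error[OF rnd \<open>\<delta> > 0\<close>])
  have step: "q (n + 1) i = q n i -
        (int_flux rnd fp \<delta> dx dt (q n i) + int_flux rnd fm \<delta> dx dt (q n (i + 1))
         - int_flux rnd fp \<delta> dx dt (q n (i - 1)) - int_flux rnd fm \<delta> dx dt (q n i))"
    using evol unfolding int_evolution_def by blast
  \<comment> \<open>An exact identity: all unrounded flux terms cancel, leaving the four errors with
    the signs of the flux difference.\<close>
  have "increment_residual fp fm dx dt (reconstruct \<delta> q) n i
      = - (e fp i + e fm (i + 1) - e fp (i - 1) - e fm i)"
    unfolding increment_residual_def reconstruct_def split_flux_def step e_def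
    by (simp add: algebra_simps)
  then show ?thesis
    using e[of fp i] e[of fm "i + 1"] e[of fp "i - 1"] e[of fm i] by linarith
qed

text \<open>The \<open>dt\<close> in the factor \<open>dt / dx\<close> of the increment cancels on
  division by \<open>dt\<close>, leaving exactly the finite-volume operator.\<close>

lemma operator_residual_eq:
  assumes "dt \<noteq> 0"
  shows "operator_residual fp fm dx dt u n i = increment_residual fp fm dx dt u n i / dt"
  using assms unfolding operator_residual_def increment_residual_def fv_operator_def
  by (simp add: diff_divide_distrib add_divide_distrib)

text \<open>Division by a positive \<open>dt\<close> preserves the inequality in both directions, so
  the two forms are equivalent constant by constant.\<close>

lemma residual_bound_iff:
  assumes "dt > 0"
  shows "\<bar>increment_residual fp fm dx dt u n i\<bar> \<le> C * \<delta>
    \<longleftrightarrow> \<bar>operator_residual fp fm dx dt u n i\<bar> \<le> C * (\<delta> / dt)"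
  using assms by (simp add: operator_residual_eq divide_le_cancel)

theorem proposition2p1:
  fixes f fp fm :: "real \<Rightarrow> real" and rnd :: "real \<Rightarrow> int"
  assumes rnd: "nearest_rounding rnd"
    and split: "\<And>x. f x = fp x + fm x"
    and fp_diff: "\<And>x. fp field_differentiable (at x)"
    and fm_diff: "\<And>x. fm field_differentiable (at x)"
    and fp_mono: "\<And>x. deriv fp x \<ge> 0"
    and fm_mono: "\<And>x. deriv fm x \<le> 0"
  shows
    "(\<exists>C::real. \<forall>\<delta> dx dt q. \<delta> > 0 \<and> dx > 0 \<and> dt > 0 \<and> int_evolution rnd fp fm \<delta> dx dt q \<longrightarrow>
        (\<forall>n i. \<bar>increment_residual fp fm dx dt (reconstruct \<delta> q) n i\<bar> \<le> C * \<delta>))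
   \<and> (\<exists>C::real. \<forall>\<delta> dx dt q. \<delta> > 0 \<and> dx > 0 \<and> dt > 0 \<and> int_evolution rnd fp fm \<delta> dx dt q \<longrightarrow>
        (\<forall>n i. \<bar>operator_residual fp fm dx dt (reconstruct \<delta> q) n i\<bar> \<le> C * (\<delta> / dt)))
   \<and> (\<forall>C::real. \<forall>\<delta> dx dt q. \<delta> > 0 \<and> dx > 0 \<and> dt > 0 \<and> int_evolution rnd fp fm \<delta> dx dt q \<longrightarrow>
        (\<forall>n i. \<bar>increment_residual fp fm dx dt (reconstruct \<delta> q) n i\<bar> \<le> C * \<delta>
           \<longleftrightarrow> \<bar>operator_residual fp fm dx dt (reconstruct \<delta> q) n i\<bar> \<le> C * (\<delta> / dt)))
   \<and> (\<forall>cfl>0. \<exists>C::real. \<forall>\<delta> dx dt q. \<delta> > 0 \<and> dx > 0 \<and> dt > 0 \<and> dt / dx = cfl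
          \<and> int_evolution rnd fp fm \<delta> dx dt q \<longrightarrow>
        (\<forall>n i. \<bar>operator_residual fp fm dx dt (reconstruct \<delta> q) n i\<bar> \<le> C * (\<delta> / dx)))"
proof (intro conjI)
  show "\<exists>C::real. \<forall>\<delta> dx dt q. \<delta> > 0 \<and> dx > 0 \<and> dt > 0 \<and> int_evolution rnd fp fm \<delta> dx dt q \<longrightarrow>
        (\<forall>n i. \<bar>increment_residual fp fm dx dt (reconstruct \<delta> q) n i\<bar> \<le> C * \<delta>)"
    using increment_residual_bound[OF rnd] by blast
  show "\<forall>C::real. \<forall>\<delta> dx dt q. \<delta> > 0 \<and> dx > 0 \<and> dt > 0 \<and> int_evolution rnd fp fm \<delta> dx dt q \<longrightarrow>
        (\<forall>n i. \<bar>increment_residual fp fm dx dt (reconstruct \<delta> q) n i\<bar> \<le> C * \<delta>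
           \<longleftrightarrow> \<bar>operator_residual fp fm dx dt (reconstruct \<delta> q) n i\<bar> \<le> C * (\<delta> / dt))"
    using residual_bound_iff by blast
  \<comment> \<open>The explicit constant 2 serves both the general operator estimate and the CFL
    estimate.\<close>
  have op: "\<bar>operator_residual fp fm dx dt (reconstruct \<delta> q) n i\<bar> \<le> 2 * (\<delta> / dt)"
    if "\<delta> > 0" "dt > 0" "int_evolution rnd fp fm \<delta> dx dt q" for \<delta> dx dt q n i
    using increment_residual_bound[OF rnd that(1,3)] residual_bound_iff[OF that(2)] by blast
  show "\<exists>C::real. \<forall>\<delta> dx dt q. \<delta> > 0 \<and> dx > 0 \<and> dt > 0 \<and> int_evolution rnd fp fm \<delta> dx dt q \<longrightarrow>
        (\<forall>n i. \<bar>operator_residual fp fm dx dt (reconstruct \<delta> q) n i\<bar> \<le> C * (\<delta> / dt))"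
    using op by blast
  show "\<forall>cfl>0. \<exists>C::real. \<forall>\<delta> dx dt q. \<delta> > 0 \<and> dx > 0 \<and> dt > 0 \<and> dt / dx = cfl
          \<and> int_evolution rnd fp fm \<delta> dx dt q \<longrightarrow>
        (\<forall>n i. \<bar>operator_residual fp fm dx dt (reconstruct \<delta> q) n i\<bar> \<le> C * (\<delta> / dx))"
  proof (intro allI impI exI)
    fix cfl \<delta> dx dt :: real and q n i
    assume *: "\<delta> > 0 \<and> dx > 0 \<and> dt > 0 \<and> dt / dx = cfl \<and> int_evolution rnd fp fm \<delta> dx dt q"
    \<comment> \<open>Since \<open>dt = cfl * dx\<close>, the constant becomes
      \<open>2 / cfl\<close>, which depends on the fixed ratio alone.\<close>
    then have "2 / cfl * (\<delta> / dx) = 2 * (\<delta> / dt)"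
      by auto
    then show "\<bar>operator_residual fp fm dx dt (reconstruct \<delta> q) n i\<bar> \<le> 2 / cfl * (\<delta> / dx)"
      using op * by simp
  qed
qed

end
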